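(* Let $a,b,c,k,l,m$ be positive integers with $c\mid ab$ and $k,l\ge m$, let $h=\frac{a^kb^l}{c^m}$ (a positive integer), and let $d_i^{\pm}=a^{2k}b^{2l}\pm i c^m$ for $i=1,2$, where each $d_i^\pm$ under consideration is a square-free positive integer. Let $F_{\Delta_d}=(1,0,-d)$ denote the form $x^2-dy^2$ and $\rho^2(F_{\Delta_d})$ its reduction. Then: (1) the cycle of $\rho^2(F_{\Delta_{d_1^+}})$ is $(1,2hc^m,-c^m)\sim(c^m,2hc^m,-1)$; (2) the cycle of $\rho^2(F_{\Delta_{d_1^-}})$ is $(1,2hc^m-2,1-(2h-1)c^m)\sim(2hc^m-c^m-1,(2h-2)c^m,-c^m)\sim(c^m,2hc^m-2c^m,-2hc^m+c^m+1)\sim(2hc^m-c^m-1,2hc^m-2,-1)$; (3) the cycle of $\rho^2(F_{\Delta_{d_2^+}})$ is $(1,2hc^m,-2c^m)\sim(2c^m,2hc^m,-1)$; (4) the cycle of $\rho^2(F_{\Delta_{d_2^-}})$ is $(1,2hc^m-2,1-2(h-1)c^m)\sim(2hc^m-2c^m-1,2(h-2)c^m,-2c^m)\sim(2c^m,2hc^m-4c^m,-2hc^m+2c^m+1)\sim(2hc^m-2c^m-1,2hc^m-2,-1)$.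
   Context: $(A,B,C)$ denotes the binary quadratic form $Ax^2+Bxy+Cy^2$, of discriminant $\Delta=B^2-4AC$. For an indefinite form $F$ write $\rho^0(F)=F$ and $\rho^j(F)=(a_j,b_j,c_j)$; then $\rho^{j+1}(F)=(c_j,-b_j+2c_jr_j,c_jr_j^2-b_jr_j+a_j)$, where $r_j=\operatorname{sign}(c_j)\lfloor b_j/(2|c_j|)\rfloor$ if $|c_j|\ge\sqrt\Delta$ and $r_j=\operatorname{sign}(c_j)\lfloor (b_j+\sqrt\Delta)/(2|c_j|)\rfloor$ if $|c_j|<\sqrt\Delta$. The cycle of a reduced indefinite form $F$ is the sequence $F_0\sim F_1\sim\dots\sim F_{l-1}$ of length $l$ with $F_0=F$ and, for $F_j=(a_j,b_j,c_j)$, $$s_j=\left\lfloor\frac{b_j+\sqrt\Delta}{2|c_j|}\right\rfloor,\qquad F_{j+1}=\big(|c_j|,\,-b_j+2|c_j|s_j,\,-(c_js_j^2+b_js_j+a_j)\big),$$ which closes up, $F_l=F_0$.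
   Formalization: Part (2) is proved for h ≥ 2 and part (4) for h ≥ 3, as the printed cycles are false for smaller h (e.g. d=30 with h=1 in (2); d=3 and d=2 with h=1, 2 in (4)); for c=1 in (1) and (2) the printed list closes up but runs twice through the minimal period. *)

theory Defs
  imports Complex_Main "HOL-Computational_Algebra.Squarefree"
begin

text \<open>The triple \<open>(A, B, C)\<close> stands for the form \<open>A x\<^sup>2 + B x y + C y\<^sup>2\<close>.\<close>

type_synonym bqf = "int \<times> int \<times> int"

fun discr :: "bqf \<Rightarrow> int" where
  "discr (a, b, c) = b\<^sup>2 - 4 * a * c"

fun rho :: "bqf \<Rightarrow> bqf" where
  "rho (a, b, c) =
     (let \<Delta> = real_of_int (discr (a, b, c));
          r = (if real_of_int \<bar>c\<bar> \<ge> sqrt \<Delta>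
               then sgn c * \<lfloor>real_of_int b / (2 * real_of_int \<bar>c\<bar>)\<rfloor>
               else sgn c * \<lfloor>(real_of_int b + sqrt \<Delta>) / (2 * real_of_int \<bar>c\<bar>)\<rfloor>)
      in (c, - b + 2 * c * r, c * r\<^sup>2 - b * r + a))"

text \<open>The usual (Gauss) notion of a reduced indefinite form.\<close>

fun reduced_indefinite :: "bqf \<Rightarrow> bool" where
  "reduced_indefinite (a, b, c) \<longleftrightarrow>
     discr (a, b, c) > 0 \<and>
     \<bar>sqrt (real_of_int (discr (a, b, c))) - 2 * real_of_int \<bar>a\<bar>\<bar> < real_of_int b \<and>
     real_of_int b < sqrt (real_of_int (discr (a, b, c)))"

fun cycle_step :: "bqf \<Rightarrow> bqf" where
  "cycle_step (a, b, c) =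
     (let s = \<lfloor>(real_of_int b + sqrt (real_of_int (discr (a, b, c)))) / (2 * real_of_int \<bar>c\<bar>)\<rfloor>
      in (\<bar>c\<bar>, - b + 2 * \<bar>c\<bar> * s, - (c * s\<^sup>2 + b * s + a)))"

text \<open>
  \<open>closed_cycle F Fs\<close>: the list \<open>Fs\<close> is \<open>F\<^sub>0, \<dots>, F\<^sub>l\<^sub>-\<^sub>1\<close> with \<open>F\<^sub>0 = F\<close> and \<open>F\<^sub>l = F\<^sub>0\<close>; it may
  run through the period of \<open>F\<close> more than once. \<open>cycle_of\<close> demands in addition that the length
  \<open>l\<close> is the least possible one.
\<close>

definition closed_cycle :: "bqf \<Rightarrow> bqf list \<Rightarrow> bool" where
  "closed_cycle F Fs \<longleftrightarrow>
     reduced_indefinite F \<and> Fs \<noteq> [] \<and>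
     (\<forall>j < length Fs. Fs ! j = (cycle_step ^^ j) F) \<and>
     (cycle_step ^^ length Fs) F = F"

definition cycle_of :: "bqf \<Rightarrow> bqf list \<Rightarrow> bool" where
  "cycle_of F Fs \<longleftrightarrow>
     closed_cycle F Fs \<and> (\<forall>j. 0 < j \<and> j < length Fs \<longrightarrow> (cycle_step ^^ j) F \<noteq> F)"

definition pell_form :: "int \<Rightarrow> bqf" where
  "pell_form d = (1, 0, - d)"

end

theory Submission
  imports Defs
begin

text \<open>
  Put \<open>N = h c\<^sup>m\<close> and \<open>E = i c\<^sup>m\<close>, so that \<open>d = N\<^sup>2 \<plusminus> E\<close> and \<open>E\<close> divides \<open>2 N\<close>. The floor of
  \<open>\<surd>d\<close> is \<open>N\<close> or \<open>N - 1\<close>, and every form involved has an even middle coefficient, so each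
  step of the cycle is an integer division by the last coefficient. All four cycles are instances
  of two computations in \<open>N\<close>, \<open>E\<close> and \<open>q = 2 N / E\<close>.
\<close>

declare cycle_step.simps [simp del] reduced_indefinite.simps [simp del]

lemma floor_sqrt_eqI:
  fixes n d :: int
  assumes "0 \<le> n" "n\<^sup>2 \<le> d" "d < (n + 1)\<^sup>2"
  shows "\<lfloor>sqrt (real_of_int d)\<rfloor> = n"
proof (rule floor_unique)
  have "(real_of_int n)\<^sup>2 \<le> real_of_int d"
    using assms(2) by (metis of_int_le_iff of_int_power)
  then show "real_of_int n \<le> sqrt (real_of_int d)"
    by (rule real_le_rsqrt)
  have "real_of_int d < (real_of_int n + 1)\<^sup>2"
    using assms(3) by (metis of_int_1 of_int_add of_int_less_iff of_int_power)
  then show "sqrt (real_of_int d) < real_of_int n + 1"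
    using assms(1) by (intro real_less_lsqrt) auto
qed

lemma sqrt_of_int_4_mult: "sqrt (real_of_int (4 * d)) = 2 * sqrt (real_of_int d)"
  by (simp add: real_sqrt_mult)

text \<open>The first application of \<open>rho\<close> has \<open>r = 0\<close> and merely swaps
  the outer coefficients. The second has last coefficient 1 and discriminant \<open>4 * d\<close>,
  so its \<open>r\<close> is the floor of \<open>sqrt d\<close>. The bound \<open>d \<ge> 2\<close>
  matters: at \<open>d = 1\<close> the first \<open>r\<close> would be -1.\<close>

lemma rho_rho_pell_form:
  assumes "d \<ge> 2" and n: "\<lfloor>sqrt (real_of_int d)\<rfloor> = n"
  shows "(rho ^^ 2) (pell_form d) = (1, 2 * n, n\<^sup>2 - d)"
proof -
  have "1 < sqrt (real_of_int d)"
    using assms by simp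
  moreover have "sqrt (real_of_int d) < real_of_int d"
    using assms(1) by (intro real_less_lsqrt) (auto simp: power2_eq_square)
  \<comment> \<open>Needed for d = 2 and d = 3, where |c| = d lies below sqrt \<Delta>. For d \<ge>
    4 the other branch of \<open>rho\<close> applies, and its numerator is already 0.\<close>
  ultimately have "\<lfloor>sqrt (real_of_int d) / real_of_int d\<rfloor> = 0"
    using assms by (simp add: floor_eq_iff)
  then have "rho (pell_form d) = (- d, 0, 1)"
    using sqrt_of_int_4_mult[of d] assms(1) by (simp add: pell_form_def Let_def)
  moreover have "rho (- d, 0, 1) = (1, 2 * n, n\<^sup>2 - d)"
    using sqrt_of_int_4_mult[of d] \<open>1 < sqrt (real_of_int d)\<close> n by (simp add: Let_def)
  ultimately show ?thesis
    by (simp add: numeral_2_eq_2)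
qed

text \<open>The discriminant is \<open>4 * d\<close>, so the factor 2 cancels against the even
  middle coefficient. For an integer divisor \<open>c > 0\<close>, taking the floor before or after
  dividing makes no difference, so the real quotient becomes \<open>(\<beta> + n) div c\<close>. The
  bounds on \<open>s\<close> say that the remainder lies between 0 and \<open>c - 1\<close>.\<close>

lemma cycle_step_eq:
  fixes a \<beta> c d n s :: int
  assumes "c > 0" and d: "\<beta>\<^sup>2 + a * c = d" and n: "\<lfloor>sqrt (real_of_int d)\<rfloor> = n"
    and s: "c * s \<le> \<beta> + n" "\<beta> + n < c * s + c"
  shows "cycle_step (a, 2 * \<beta>, - c) = (c, 2 * (c * s - \<beta>), c * s\<^sup>2 - 2 * \<beta> * s - a)"
proof -
  have "discr (a, 2 * \<beta>, - c) = 4 * d"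
    using d by (simp add: power2_eq_square)
  then have "(real_of_int (2 * \<beta>) + sqrt (real_of_int (discr (a, 2 * \<beta>, - c)))) / (2 * real_of_int \<bar>- c\<bar>)
      = (real_of_int \<beta> + sqrt (real_of_int d)) / real_of_int c"
    using \<open>c > 0\<close> sqrt_of_int_4_mult[of d] by (simp add: field_simps)
  also have "\<lfloor>\<dots>\<rfloor> = \<lfloor>real_of_int \<beta> + sqrt (real_of_int d)\<rfloor> div c"
    using \<open>c > 0\<close> by (simp add: floor_divide_real_eq_div)
  also have "\<dots> = (\<beta> + n) div c"
    using n by simp
  also have "\<dots> = s"
    using s \<open>c > 0\<close> by (intro int_div_pos_eq[of _ _ _ "\<beta> + n - c * s"]) auto
  finally show ?thesis
    using \<open>c > 0\<close> unfolding cycle_step.simps Let_def by (simp add: algebra_simps)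
qed

text \<open>With discriminant \<open>4 * d\<close>, reducedness reads |2 sqrt d - 2| < 2 n < 2 sqrt
  d. As sqrt d > n \<ge> 1 the absolute value opens, leaving n < sqrt d < n + 1. The left inequality
  is strict, hence the strict \<open>n\<^sup>2 < d\<close>.\<close>

lemma reduced_indefinite_principal:
  fixes n d :: int
  assumes "n > 0" "n\<^sup>2 < d" "d < (n + 1)\<^sup>2"
  shows "reduced_indefinite (1, 2 * n, n\<^sup>2 - d)"
proof -
  have n: "\<lfloor>sqrt (real_of_int d)\<rfloor> = n"
    using assms by (intro floor_sqrt_eqI) auto
  have "(real_of_int n)\<^sup>2 < real_of_int d"
    using assms(2) by (metis of_int_less_iff of_int_power)
  then have "real_of_int n < sqrt (real_of_int d)"
    by (rule real_less_rsqrt)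
  moreover have "sqrt (real_of_int d) < real_of_int n + 1"
    using n by linarith
  moreover have "discr (1, 2 * n, n\<^sup>2 - d) = 4 * d"
    by (simp add: power2_eq_square)
  moreover have "d > 0"
    using assms(2) by (smt (verit) zero_le_power2)
  ultimately show ?thesis
    using assms(1) sqrt_of_int_4_mult[of d] by (simp add: reduced_indefinite.simps del: discr.simps)
qed

lemma closed_cycle_2:
  assumes "reduced_indefinite F" "cycle_step F = G" "cycle_step G = F"
  shows "closed_cycle F [F, G]"
  using assms by (auto simp: closed_cycle_def less_Suc_eq)

lemma closed_cycle_4:
  assumes "reduced_indefinite F" "cycle_step F = G" "cycle_step G = H" "cycle_step H = I"
    "cycle_step I = F"
  shows "closed_cycle F [F, G, H, I]"
  using assms by (auto simp: closed_cycle_def less_Suc_eq)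

text \<open>In a closed cycle the iterates with 0 < j < l are exactly the later entries of the list,
  so an early return to \<open>F\<close> would put \<open>F\<close> among them.\<close>

lemma cycle_ofI:
  assumes "closed_cycle F (F # Fs)" "F \<notin> set Fs"
  shows "cycle_of F (F # Fs)"
  unfolding cycle_of_def
proof (intro conjI allI impI)
  fix j assume j: "0 < j \<and> j < length (F # Fs)"
  then have "(cycle_step ^^ j) F = (F # Fs) ! j"
    using assms(1) by (auto simp: closed_cycle_def)
  also have "\<dots> \<in> set Fs"
    using j by (auto simp: nth_Cons')
  finally show "(cycle_step ^^ j) F \<noteq> F"
    using assms(2) by auto
qed (fact assms(1))

text \<open>As E \<le> 2 N, the floor of sqrt (N^2 + E) is N, and the two step quotients are
  \<open>q\<close> and \<open>2 * N\<close>. For \<open>E = 1\<close> both listed forms are (1, 2 N,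
  -1), so the true period is 1 and only \<open>closed_cycle\<close> survives.\<close>

lemma cycle_square_plus:
  fixes N E q :: int
  assumes "E > 0" "q > 0" "E * q = 2 * N"
  defines "F \<equiv> (rho ^^ 2) (pell_form (N\<^sup>2 + E))"
    and "Fs \<equiv> [(1, 2 * N, - E), (E, 2 * N, - 1)]"
  shows "closed_cycle F Fs" and "E \<noteq> 1 \<Longrightarrow> cycle_of F Fs"
proof -
  have "E * 1 \<le> E * q"
    using assms(1,2) by (intro mult_left_mono) auto
  then have "E \<le> 2 * N"
    using assms(3) by simp
  then have "N > 0"
    using assms(1) by simp
  have less: "N\<^sup>2 + E < (N + 1)\<^sup>2"
    using \<open>E \<le> 2 * N\<close> by (simp add: power2_eq_square algebra_simps)
  have n: "\<lfloor>sqrt (real_of_int (N\<^sup>2 + E))\<rfloor> = N"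
    using less \<open>N > 0\<close> \<open>E > 0\<close> by (intro floor_sqrt_eqI) auto
  have "N\<^sup>2 > 0"
    using \<open>N > 0\<close> by simp
  then have "N\<^sup>2 + E \<ge> 2"
    using \<open>E > 0\<close> by linarith
  then have F: "F = (1, 2 * N, - E)"
    using rho_rho_pell_form[OF _ n] by (simp add: F_def)
  have red: "reduced_indefinite (1, 2 * N, - E)"
    using reduced_indefinite_principal[of N "N\<^sup>2 + E"] less \<open>N > 0\<close> \<open>E > 0\<close> by simp
  \<comment> \<open>The quotient is exact, N + N = E q. Hence the quadratic and linear terms of the
    new last coefficient cancel, leaving -1.\<close>
  have "E * q\<^sup>2 = 2 * N * q"
    using assms(3) by (simp add: power2_eq_square flip: mult.assoc)
  then have 1: "cycle_step (1, 2 * N, - E) = (E, 2 * N, - 1)"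
    using cycle_step_eq[of E N 1 "N\<^sup>2 + E" N q] n assms(1,3) by simp
  have 2: "cycle_step (E, 2 * N, - 1) = (1, 2 * N, - E)"
    using cycle_step_eq[of 1 N E "N\<^sup>2 + E" N "2 * N"] n by (simp add: power2_eq_square)
  show cl: "closed_cycle F Fs"
    unfolding F Fs_def by (rule closed_cycle_2[OF red 1 2])
  show "cycle_of F Fs" if "E \<noteq> 1"
    using cl that unfolding F Fs_def by (intro cycle_ofI) auto
qed

text \<open>Here the floor of sqrt (N^2 - E) is N - 1, and \<open>C\<close> is the defect N^2 - E -
  (N - 1)^2. The step quotients are 1, \<open>q - 2\<close>, 1 and \<open>2 * (N - 1)\<close>. The
  bound \<open>q \<ge> 3\<close> gives 3 E \<le> 2 N, which makes \<open>C\<close> positive and E <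
  N. For \<open>E = 1\<close> the third form equals the first and the period halves.\<close>

lemma cycle_square_minus:
  fixes N E q :: int
  assumes "E > 0" "q \<ge> 3" "E * q = 2 * N"
  defines "C \<equiv> 2 * N - E - 1"
  defines "F \<equiv> (rho ^^ 2) (pell_form (N\<^sup>2 - E))"
    and "Fs \<equiv> [(1, 2 * (N - 1), - C), (C, 2 * (N - E), - E), (E, 2 * (N - E), - C),
      (C, 2 * (N - 1), - 1)]"
  shows "closed_cycle F Fs" and "E \<noteq> 1 \<Longrightarrow> cycle_of F Fs"
proof -
  have "E * 3 \<le> E * q"
    using assms(1,2) by (intro mult_left_mono) auto
  then have EN: "3 * E \<le> 2 * N"
    using assms(3) by simp
  then have "N \<ge> 2" "C > 0"
    using assms(1) by (auto simp: C_def)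
  have less: "(N - 1)\<^sup>2 < N\<^sup>2 - E"
    using EN \<open>N \<ge> 2\<close> \<open>E > 0\<close> by (simp add: power2_eq_square algebra_simps)
  have n: "\<lfloor>sqrt (real_of_int (N\<^sup>2 - E))\<rfloor> = N - 1"
    using less \<open>N \<ge> 2\<close> \<open>E > 0\<close> by (intro floor_sqrt_eqI) auto
  have d: "(N - 1)\<^sup>2 - (N\<^sup>2 - E) = - C"
    by (simp add: C_def power2_eq_square algebra_simps)
  have "(N - 1)\<^sup>2 > 0"
    using \<open>N \<ge> 2\<close> by simp
  then have "N\<^sup>2 - E \<ge> 2"
    using less by linarith
  then have F: "F = (1, 2 * (N - 1), - C)"
    using rho_rho_pell_form[OF _ n] d by (simp add: F_def)
  have red: "reduced_indefinite (1, 2 * (N - 1), - C)"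
    using reduced_indefinite_principal[of "N - 1" "N\<^sup>2 - E"] less \<open>N \<ge> 2\<close> \<open>E > 0\<close> d by simp
  \<comment> \<open>The quotient is 1 because C \<le> 2 (N - 1) < 2 C: the left inequality is E
    \<ge> 1, the right one E < N.\<close>
  have 1: "cycle_step (1, 2 * (N - 1), - C) = (C, 2 * (N - E), - E)"
    using cycle_step_eq[of C "N - 1" 1 "N\<^sup>2 - E" "N - 1" 1] n d \<open>C > 0\<close> \<open>E > 0\<close> EN
    by (simp add: C_def)
  \<comment> \<open>The sum to be divided by E is (N - E) + (N - 1) = E (q - 1) - 1, one short of a
    multiple of E. So the quotient is \<open>q - 2\<close> with remainder E - 1.\<close>
  have s: "E * (q - 2) = 2 * (N - E)"
    using assms(3) by (simp add: algebra_simps)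
  then have "E * (q - 2)\<^sup>2 = 2 * (N - E) * (q - 2)"
    by (simp add: power2_eq_square flip: mult.assoc)
  moreover have d': "(N - E)\<^sup>2 + C * E = N\<^sup>2 - E"
    by (simp add: C_def power2_eq_square algebra_simps)
  ultimately have 2: "cycle_step (C, 2 * (N - E), - E) = (E, 2 * (N - E), - C)"
    using cycle_step_eq[of E "N - E" C "N\<^sup>2 - E" "N - 1" "q - 2"] n s \<open>E > 0\<close> by simp
  \<comment> \<open>The division is exact here: (N - E) + (N - 1) = C.\<close>
  have 3: "cycle_step (E, 2 * (N - E), - C) = (C, 2 * (N - 1), - 1)"
    using cycle_step_eq[of C "N - E" E "N\<^sup>2 - E" "N - 1" 1] n d' \<open>C > 0\<close>
    by (simp add: C_def mult.commute)
  have 4: "cycle_step (C, 2 * (N - 1), - 1) = (1, 2 * (N - 1), - C)"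
    using cycle_step_eq[of 1 "N - 1" C "N\<^sup>2 - E" "N - 1" "2 * (N - 1)"] n d
    by (simp add: power2_eq_square)
  show cl: "closed_cycle F Fs"
    unfolding F Fs_def by (rule closed_cycle_4[OF red 1 2 3 4])
  \<comment> \<open>Leading coefficients already separate \<open>F\<close> from the later forms:
    they are E and C, and C \<ge> 2 E - 1 > 1.\<close>
  show "cycle_of F Fs" if "E \<noteq> 1"
    using cl that EN \<open>E > 0\<close> unfolding F Fs_def by (intro cycle_ofI) (auto simp: C_def)
qed

theorem theorem5p4:
  fixes a b c h :: int and k l m :: nat and dp dm :: "int \<Rightarrow> int"
  assumes "a > 0" "b > 0" "c > 0" "k > 0" "l > 0" "m > 0"
    and "c dvd a * b" and "k \<ge> m" and "l \<ge> m"
    and "h = (a ^ k * b ^ l) div c ^ m"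
    and "\<And>i. dp i = a ^ (2 * k) * b ^ (2 * l) + i * c ^ m"
    and "\<And>i. dm i = a ^ (2 * k) * b ^ (2 * l) - i * c ^ m"
  shows "c ^ m dvd a ^ k * b ^ l \<and> h > 0 \<and>
    (dp 1 > 0 \<and> squarefree (dp 1) \<longrightarrow>
      (let F = (rho ^^ 2) (pell_form (dp 1));
           Fs = [(1, 2 * h * c ^ m, - (c ^ m)),
                 (c ^ m, 2 * h * c ^ m, - 1)]
       in closed_cycle F Fs \<and> (c \<noteq> 1 \<longrightarrow> cycle_of F Fs))) \<and>
    (dm 1 > 0 \<and> squarefree (dm 1) \<and> h \<ge> 2 \<longrightarrow>
      (let F = (rho ^^ 2) (pell_form (dm 1));
           Fs = [(1, 2 * h * c ^ m - 2, 1 - (2 * h - 1) * c ^ m),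
                 (2 * h * c ^ m - c ^ m - 1, (2 * h - 2) * c ^ m, - (c ^ m)),
                 (c ^ m, 2 * h * c ^ m - 2 * c ^ m, - 2 * h * c ^ m + c ^ m + 1),
                 (2 * h * c ^ m - c ^ m - 1, 2 * h * c ^ m - 2, - 1)]
       in closed_cycle F Fs \<and> (c \<noteq> 1 \<longrightarrow> cycle_of F Fs))) \<and>
    (dp 2 > 0 \<and> squarefree (dp 2) \<longrightarrow>
      cycle_of ((rho ^^ 2) (pell_form (dp 2)))
        [(1, 2 * h * c ^ m, - 2 * c ^ m),
         (2 * c ^ m, 2 * h * c ^ m, - 1)]) \<and>
    (dm 2 > 0 \<and> squarefree (dm 2) \<and> h \<ge> 3 \<longrightarrow>
      cycle_of ((rho ^^ 2) (pell_form (dm 2)))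
        [(1, 2 * h * c ^ m - 2, 1 - 2 * (h - 1) * c ^ m),
         (2 * h * c ^ m - 2 * c ^ m - 1, 2 * (h - 2) * c ^ m, - 2 * c ^ m),
         (2 * c ^ m, 2 * h * c ^ m - 4 * c ^ m, - 2 * h * c ^ m + 2 * c ^ m + 1),
         (2 * h * c ^ m - 2 * c ^ m - 1, 2 * h * c ^ m - 2, - 1)])"
proof -
  define e where "e = c ^ m"
  have "e > 0"
    using \<open>c > 0\<close> by (simp add: e_def)
  have "e dvd (a * b) ^ m"
    using \<open>c dvd a * b\<close> by (simp add: e_def dvd_power_same)
  also have "\<dots> dvd a ^ k * b ^ l"
    using \<open>k \<ge> m\<close> \<open>l \<ge> m\<close> by (simp add: power_mult_distrib mult_dvd_mono le_imp_power_dvd)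
  finally have dvd: "e dvd a ^ k * b ^ l" .
  then have he: "h * e = a ^ k * b ^ l"
    using assms(10) by (simp add: e_def)
  then have "h * e > 0"
    using \<open>a > 0\<close> \<open>b > 0\<close> by simp
  then have "h > 0"
    using \<open>e > 0\<close> by (simp add: zero_less_mult_iff)
  have "a ^ (2 * k) * b ^ (2 * l) = (h * e)\<^sup>2"
    unfolding he by (simp add: power_mult_distrib mult.commute flip: power_mult)
  then have dp: "dp i = (h * e)\<^sup>2 + i * e" and dm: "dm i = (h * e)\<^sup>2 - i * e" for i
    using assms(11,12) by (simp_all add: e_def)
  \<comment> \<open>For i = 1 the exceptional case \<open>E = 1\<close> is exactly c = 1, since m >
    0.\<close>
  have e1: "e \<noteq> 1" if "c \<noteq> 1"
    using that \<open>c > 0\<close> \<open>m > 0\<close> one_less_power[of c m] unfolding e_def by linarith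
  \<comment> \<open>These identities rewrite the stated entries in terms of N = h e, with E = e here
    and E = 2 e in \<open>forms2\<close>.\<close>
  have forms1: "1 - (2 * h - 1) * e = - (2 * (h * e) - e - 1)"
    "(2 * h - 2) * e = 2 * (h * e - e)" "2 * h * e - 2 * e = 2 * (h * e - e)"
    "- 2 * h * e + e + 1 = - (2 * (h * e) - e - 1)" "2 * h * e - 2 = 2 * (h * e - 1)"
    "2 * h * e - e - 1 = 2 * (h * e) - e - 1"
    by (simp_all add: algebra_simps)
  have forms2: "1 - 2 * (h - 1) * e = - (2 * (h * e) - 2 * e - 1)"
    "2 * (h - 2) * e = 2 * (h * e - 2 * e)" "2 * h * e - 4 * e = 2 * (h * e - 2 * e)"
    "- 2 * h * e + 2 * e + 1 = - (2 * (h * e) - 2 * e - 1)" "- 2 * e = - (2 * e)"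
    "2 * h * e - 2 * e - 1 = 2 * (h * e) - 2 * e - 1"
    by (simp_all add: algebra_simps)
  \<comment> \<open>By parity the exceptional case never occurs for i = 2, so there the listed
    cycles always have least length.\<close>
  have two_e: "2 * e \<noteq> 1"
    by presburger
  \<comment> \<open>The quotient q = 2 N / E is \<open>2 * h\<close> for E = e and \<open>h\<close>
    for E = 2 e. The bound q \<ge> 3 thus becomes h \<ge> 2 in the first case and h \<ge> 3 in the
    second.\<close>
  have "e * (2 * h) = 2 * (h * e)" "2 * e * h = 2 * (h * e)"
    by simp_all
  note plus1 = cycle_square_plus[OF \<open>e > 0\<close> _ this(1)]
    and minus1 = cycle_square_minus[OF \<open>e > 0\<close> _ this(1)]
    and plus2 = cycle_square_plus(2)[OF _ \<open>h > 0\<close> this(2) two_e]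
    and minus2 = cycle_square_minus(2)[OF _ _ this(2) two_e]
  show ?thesis
    unfolding e_def[symmetric] Let_def dp dm mult_1
  proof (intro conjI impI; (elim conjE)?)
    show "e dvd a ^ k * b ^ l" "h > 0"
      by fact+
    show "closed_cycle ((rho ^^ 2) (pell_form ((h * e)\<^sup>2 + e)))
        [(1, 2 * h * e, - e), (e, 2 * h * e, - 1)]"
      using plus1(1) \<open>h > 0\<close> by (simp add: mult.assoc)
    show "cycle_of ((rho ^^ 2) (pell_form ((h * e)\<^sup>2 + e)))
        [(1, 2 * h * e, - e), (e, 2 * h * e, - 1)]" if "c \<noteq> 1"
      using plus1(2) e1[OF that] \<open>h > 0\<close> by (simp add: mult.assoc)
    show "cycle_of ((rho ^^ 2) (pell_form ((h * e)\<^sup>2 + 2 * e)))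
        [(1, 2 * h * e, - 2 * e), (2 * e, 2 * h * e, - 1)]"
      using plus2 \<open>e > 0\<close> by (simp add: mult.assoc)
  next
    assume "h \<ge> 2"
    then have q: "2 * h \<ge> 3"
      by simp
    show "closed_cycle ((rho ^^ 2) (pell_form ((h * e)\<^sup>2 - e)))
        [(1, 2 * h * e - 2, 1 - (2 * h - 1) * e), (2 * h * e - e - 1, (2 * h - 2) * e, - e),
         (e, 2 * h * e - 2 * e, - 2 * h * e + e + 1), (2 * h * e - e - 1, 2 * h * e - 2, - 1)]"
      unfolding forms1 by (rule minus1(1)[OF q])
    show "cycle_of ((rho ^^ 2) (pell_form ((h * e)\<^sup>2 - e)))
        [(1, 2 * h * e - 2, 1 - (2 * h - 1) * e), (2 * h * e - e - 1, (2 * h - 2) * e, - e),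
         (e, 2 * h * e - 2 * e, - 2 * h * e + e + 1), (2 * h * e - e - 1, 2 * h * e - 2, - 1)]"
      if "c \<noteq> 1"
      unfolding forms1 by (rule minus1(2)[OF q e1[OF that]])
  next
    assume "h \<ge> 3"
    then show "cycle_of ((rho ^^ 2) (pell_form ((h * e)\<^sup>2 - 2 * e)))
        [(1, 2 * h * e - 2, 1 - 2 * (h - 1) * e),
         (2 * h * e - 2 * e - 1, 2 * (h - 2) * e, - 2 * e),
         (2 * e, 2 * h * e - 4 * e, - 2 * h * e + 2 * e + 1),
         (2 * h * e - 2 * e - 1, 2 * h * e - 2, - 1)]"
      unfolding forms1(5) forms2 using \<open>e > 0\<close> by (intro minus2) auto
  qed
qed

end
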